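(* Let $f:\mathbb{R}^n\to\mathbb{R}$ be convex and twice differentiable with $\|\nabla^2 f(x)-\nabla^2 f(y)\|\le L_3(f)\|x-y\|$ for all $x,y\in\mathbb{R}^n$, where $L_3(f)>0$, and let $x^*$ be a minimizer of $f$ on $\mathbb{R}^n$. Let the sequence $\{x_k\}_{k\ge 1}$ be generated from $x_0\in\mathbb{R}^n$ by the modified accelerated cubic Newton method (described in the context) with the parameters $M=2L_3(f)$, $C=\frac{12L_3(f)}{(\sqrt2-1)^2}$, $a_k=\frac{(k+1)(k+2)}{2}$, $A_1=1$. Then, for any $k\ge 1$, $$f(x_k)-f(x^* )+\frac{1}{\sqrt{3L_3(f)}}\|\nabla f(x_k)\|^{3/2}\le \frac{80L_3(f)\|x_0-x^*\|^3}{k(k+1)(k+2)}.$$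
   Context: $\|\cdot\|$ is the Euclidean norm on $\mathbb{R}^n$ and the induced operator norm on matrices. For $M>0$, $T_M(x)$ denotes a global minimizer over $y\in\mathbb{R}^n$ of $$f(x)+\langle\nabla f(x),y-x\rangle+\tfrac12\langle\nabla^2 f(x)(y-x),y-x\rangle+\tfrac{M}{6}\|y-x\|^3 .$$ Modified accelerated cubic Newton method (inputs: $x_0\in\mathbb{R}^n$, $a_k>0$ for $k\ge1$, $A_1>0$, $M$, $C$). Compute $x_1=T_{L_3(f)}(x_0)$ and define $$f_1(x):=f(x_1)+\tfrac{1}{\sqrt{L_3(f)+M}}\|\nabla f(x_1)\|^{3/2}+\tfrac{C}{6}\|x-x_0\|^3 .$$ For $k=1,2,\dots$: 1. Compute $\nu_k=\arg\min_{x\in\mathbb{R}^n}f_k(x)$; set $A_{k+1}=A_k+a_k$, $\alpha_k=a_k/A_{k+1}$, and $y_k=(1-\alpha_k)x_k+\alpha_k\nu_k$. 2. Compute $x_{k+1}=T_M(y_k)$ and set $f_{k+1}(x)=f_k(x)+a_k\big(f(x_{k+1})+\langle\nabla f(x_{k+1}),x-x_{k+1}\rangle\big)$. *)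

theory Defs
  imports "HOL-Analysis.Analysis"
begin

text \<open>
  Both are junk values where the derivative does not exist, so statements using them must
  assume differentiability separately. The Hessian is the Jacobian matrix of the gradient.
\<close>

definition grad :: "(real ^ 'n \<Rightarrow> real) \<Rightarrow> real ^ 'n \<Rightarrow> real ^ 'n" where
  "grad f x = (THE D. GDERIV f x :> D)"

definition hessian :: "(real ^ 'n \<Rightarrow> real) \<Rightarrow> real ^ 'n \<Rightarrow> real ^ 'n ^ 'n" where
  "hessian f x = jacobian (grad f) (at x)"

definition twice_differentiable :: "(real ^ 'n \<Rightarrow> real) \<Rightarrow> bool" where
  "twice_differentiable f \<longleftrightarrow> f differentiable_on UNIV \<and> grad f differentiable_on UNIV"

definition matrix_opnorm :: "real ^ 'n ^ 'm \<Rightarrow> real" where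
  "matrix_opnorm A = onorm (\<lambda>v. A *v v)"

abbreviation is_minimizer :: "(real ^ 'n \<Rightarrow> real) \<Rightarrow> real ^ 'n \<Rightarrow> bool" where
  "is_minimizer g z \<equiv> is_arg_min g (\<lambda>_. True) z"

definition cubic_model :: "(real ^ 'n \<Rightarrow> real) \<Rightarrow> real \<Rightarrow> real ^ 'n \<Rightarrow> real ^ 'n \<Rightarrow> real" where
  "cubic_model f M x y =
     f x + grad f x \<bullet> (y - x) + 1/2 * ((hessian f x *v (y - x)) \<bullet> (y - x))
       + M / 6 * norm (y - x) ^ 3"

text \<open>
  \<open>T\<^sub>M(x)\<close> is rendered as a relation, since it stands for an arbitrary choice of global
  minimizer of the cubic model.
\<close>

definition cubic_step :: "(real ^ 'n \<Rightarrow> real) \<Rightarrow> real \<Rightarrow> real ^ 'n \<Rightarrow> real ^ 'n \<Rightarrow> bool" where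
  "cubic_step f M x z \<longleftrightarrow> is_minimizer (cubic_model f M x) z"

text \<open>
  \<open>x\<close> is a run of the method on \<open>f\<close>, started at \<open>x 0\<close>. The parameter \<open>L\<close> is the Lipschitz
  constant of the Hessian. The auxiliary sequences \<open>A\<close>, \<open>\<nu>\<close>, \<open>y\<close> and the estimating functions
  \<open>\<phi> k\<close> (written \<open>f\<^sub>k\<close> in the usual notation) are indexed from 1; their values at 0 are
  unconstrained.
\<close>

definition modified_accelerated_cubic_newton ::
  "(real ^ 'n \<Rightarrow> real) \<Rightarrow> real \<Rightarrow> real \<Rightarrow> real \<Rightarrow> (nat \<Rightarrow> real) \<Rightarrow> real \<Rightarrow> (nat \<Rightarrow> real ^ 'n) \<Rightarrow> bool" where
  "modified_accelerated_cubic_newton f L M C a A1 x \<longleftrightarrow>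
     (\<exists>(A :: nat \<Rightarrow> real) (\<phi> :: nat \<Rightarrow> real ^ 'n \<Rightarrow> real) (\<nu> :: nat \<Rightarrow> real ^ 'n) (y :: nat \<Rightarrow> real ^ 'n).
        cubic_step f L (x 0) (x 1) \<and>
        A 1 = A1 \<and>
        \<phi> 1 = (\<lambda>z. f (x 1) + 1 / sqrt (L + M) * norm (grad f (x 1)) powr (3/2)
                      + C / 6 * norm (z - x 0) ^ 3) \<and>
        (\<forall>k\<ge>1.
           is_minimizer (\<phi> k) (\<nu> k) \<and>
           A (k + 1) = A k + a k \<and>
           (let \<alpha> = a k / A (k + 1) in y k = (1 - \<alpha>) *\<^sub>R x k + \<alpha> *\<^sub>R \<nu> k) \<and>
           cubic_step f M (y k) (x (k + 1)) \<and>
           \<phi> (k + 1) = (\<lambda>z. \<phi> k z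
              + a k * (f (x (k + 1)) + grad f (x (k + 1)) \<bullet> (z - x (k + 1))))))"

end

theory Submission imports Defs begin

text \<open>
  Write \<open>R = \<parallel>x\<^sub>0 - x\<^sup>*\<parallel>\<close> and \<open>c = 1/sqrt (3 L)\<close>. A step \<open>z = T\<^sub>2\<^sub>L(y)\<close> satisfies
  \<open>\<langle>\<nabla>f(z), y - z\<rangle> \<ge> sqrt 2 * c * \<parallel>\<nabla>f(z)\<parallel>\<^sup>3\<^sup>/\<^sup>2\<close>, and estimating sequences give
  \<open>A\<^sub>k f(x\<^sub>k) + c \<parallel>\<nabla>f(x\<^sub>1)\<parallel>\<^sup>3\<^sup>/\<^sup>2 \<le> min f\<^sub>k\<close>. Carrying the full term
  \<open>A\<^sub>k c \<parallel>\<nabla>f(x\<^sub>k)\<parallel>\<^sup>3\<^sup>/\<^sup>2\<close> through the induction fails for \<open>k \<ge> 3\<close>: with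
  the standard uniform convexity bound for \<open>\<parallel>\<cdot>\<parallel>\<^sup>3\<close>, the parameter \<open>C\<close> is asymptotically
  too small by a factor 2. So the gradient term is recovered only in the last step,
  where the estimating function is evaluated at \<open>x\<^sup>*\<close> instead of being minimised. There the
  Bregman distance of \<open>\<parallel>\<cdot> - x\<^sub>0\<parallel>\<^sup>3\<close> from \<open>\<nu>\<^sub>k\<close> to \<open>x\<^sup>*\<close> is already known to be at most
  slightly larger than \<open>R\<^sup>3\<close>, which forces \<open>\<parallel>\<nu>\<^sub>k - x\<^sup>*\<parallel> \<le> 1.1 R\<close> and improves the
  convexity constant enough to reach 80.
\<close>

subsection \<open>Scalar inequalities\<close>

lemma powr_three_halves: "G powr (3/2) = G * sqrt G" if "G \<ge> 0" for G :: real
proof -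
  have "G powr (1 + 1/2) = G powr 1 * G powr (1/2)" by (rule powr_add)
  then show ?thesis using that by (simp add: powr_half_sqrt)
qed

text \<open>With M = 2L, a cubic step of length r leaves a gradient of norm at most 3/2 L r^2 (see
  \<open>cubic_step_grad\<close>), so \<open>v\<close> is the least step length compatible with the
  norm \<open>G\<close>. Measured in \<open>v\<close>, all gradient terms become multiples of L v^3,
  comparable with cubed distances.\<close>

lemma gradient_scale:
  fixes L G :: real
  assumes "L > 0" "G \<ge> 0"
  defines "v \<equiv> sqrt (2 * G / (3 * L))"
  shows "v \<ge> 0" "G = 3/2 * L * v\<^sup>2"
    "1 / sqrt (3 * L) * G powr (3/2) = 3/4 * sqrt 2 * L * v ^ 3"
proof -
  show v0: "v \<ge> 0" using assms by (simp add: v_def)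
  show G: "G = 3/2 * L * v\<^sup>2" using assms by (simp add: v_def)
  have "sqrt G = sqrt ((3 * L) / 2) * v"
    unfolding G using v0 real_sqrt_mult[of "3 * L / 2" "v\<^sup>2"] by simp
  also have "\<dots> = sqrt (3 * L) / sqrt 2 * v"
    by (simp only: real_sqrt_divide)
  finally have s: "sqrt G = sqrt (3 * L) / sqrt 2 * v" .
  have "1 / sqrt (3 * L) * G powr (3/2) = G * v / sqrt 2"
    using assms by (simp add: powr_three_halves s)
  also have "\<dots> = 3/4 * sqrt 2 * L * v ^ 3"
    by (simp add: G power2_eq_square power3_eq_cube divide_simps)
  finally show "1 / sqrt (3 * L) * G powr (3/2) = 3/4 * sqrt 2 * L * v ^ 3" .
qed

text \<open>Young's inequality with exponents 3/2 and 3; after scaling h = \<tau> g it is (v - g)^2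
  (g + 2v) \<ge> 0. The free weight \<tau> trades gradient terms against distance terms.\<close>

lemma young_cubic:
  fixes v h \<tau> :: real
  assumes "v \<ge> 0" "h \<ge> 0" "\<tau> > 0"
  shows "3 * v\<^sup>2 * h \<le> h ^ 3 / \<tau>\<^sup>2 + 2 * \<tau> * v ^ 3"
proof -
  define g where "g = h / \<tau>"
  have h: "h = \<tau> * g" and g: "g \<ge> 0" using assms by (auto simp: g_def)
  have "0 \<le> \<tau> * ((v - g)\<^sup>2 * (g + 2 * v))" using assms g by simp
  also have "\<dots> = \<tau> * g ^ 3 + 2 * \<tau> * v ^ 3 - 3 * v\<^sup>2 * h"
    unfolding h by (simp add: power2_eq_square power3_eq_cube algebra_simps)
  also have "\<tau> * g ^ 3 = h ^ 3 / \<tau>\<^sup>2"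
    unfolding h using assms by (simp add: power2_eq_square power3_eq_cube)
  finally show ?thesis by simp
qed

text \<open>Takes the place of the limit t \<rightarrow> 0 in the expansions below.\<close>

lemma nonpos_if_le_linear:
  fixes X K :: real
  assumes "\<And>t. 0 < t \<Longrightarrow> t \<le> 1 \<Longrightarrow> X \<le> K * t"
  shows "X \<le> 0"
proof (rule ccontr)
  assume "\<not> X \<le> 0"
  then have X: "X > 0" by simp
  define t where "t = min 1 (X / (2 * (\<bar>K\<bar> + 1)))"
  have t: "0 < t" "t \<le> 1" "t \<le> X / (2 * (\<bar>K\<bar> + 1))" using X by (auto simp: t_def)
  have "K * t \<le> (\<bar>K\<bar> + 1) * t" using t by (intro mult_right_mono) auto
  also have "\<dots> \<le> (\<bar>K\<bar> + 1) * (X / (2 * (\<bar>K\<bar> + 1)))" using t by (intro mult_left_mono) auto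
  also have "\<dots> = X / 2" by (simp add: field_simps)
  finally show False using assms[OF t(1,2)] X by linarith
qed

subsection \<open>Bregman distance of the cubed norm\<close>

definition cubic_bregman :: "'a::real_inner \<Rightarrow> 'a \<Rightarrow> real" where
  "cubic_bregman p z = norm z ^ 3 - norm p ^ 3 - 3 * norm p * (p \<bullet> (z - p))"

text \<open>Both summands are nonnegative and involve only three lengths, so the bounds below become
  scalar inequalities with the triangle inequality as constraint.\<close>

lemma cubic_bregman_eq:
  "cubic_bregman p z = 3/2 * norm p * (norm (z - p))\<^sup>2
     + (norm z - norm p)\<^sup>2 * (norm z + norm p / 2)"
proof -
  have e: "(norm (z - p))\<^sup>2 = (norm z)\<^sup>2 - 2 * (p \<bullet> z) + (norm p)\<^sup>2"
    by (simp add: power2_norm_eq_inner inner_diff inner_commute)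
  have i: "p \<bullet> (z - p) = p \<bullet> z - (norm p)\<^sup>2"
    by (simp add: power2_norm_eq_inner inner_diff)
  show ?thesis unfolding cubic_bregman_def e i
    by (simp add: power2_eq_square power3_eq_cube algebra_simps)
qed

text \<open>A remainder quadratic for small \<open>w\<close>: it yields first-order conditions
  without differentiating the cubed norm.\<close>

lemma cubic_bregman_le:
  "cubic_bregman p (p + w) \<le> 3 * norm p * (norm w)\<^sup>2 + norm w ^ 3"
proof -
  have "\<bar>norm (p + w) - norm p\<bar> \<le> norm w"
    using norm_triangle_ineq3[of "p + w" p] by simp
  then have a: "(norm (p + w) - norm p)\<^sup>2 \<le> (norm w)\<^sup>2"
    by (metis abs_le_square_iff abs_norm_cancel)
  have b: "norm (p + w) + norm p / 2 \<le> norm w + 3/2 * norm p"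
    using norm_triangle_ineq[of p w] by simp
  have "(norm (p + w) - norm p)\<^sup>2 * (norm (p + w) + norm p / 2)
      \<le> (norm w)\<^sup>2 * (norm w + 3/2 * norm p)"
    by (rule mult_mono[OF a b]) auto
  then show ?thesis
    by (simp add: cubic_bregman_eq power2_eq_square power3_eq_cube algebra_simps)
qed

lemma cubic_bregman_ge:
  "norm (z - p) ^ 3 \<le> 6 * cubic_bregman p z"
proof -
  define n R h where "n = norm p" and "R = norm z" and "h = norm (z - p)"
  have nn: "n \<ge> 0" "R \<ge> 0" "h \<ge> 0" "h \<le> R + n"
    using norm_triangle_ineq4[of z p] by (auto simp: n_def R_def h_def)
  define P Q where "P = (R - n)\<^sup>2 * (R + n / 2)" and "Q = n * h\<^sup>2"
  have B: "cubic_bregman p z = 3/2 * Q + P"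
    by (simp add: cubic_bregman_eq n_def R_def h_def P_def Q_def)
  have PQ: "P \<ge> 0" "Q \<ge> 0" using nn by (auto simp: P_def Q_def)
  have h3: "h ^ 3 = h * h\<^sup>2" by (simp add: power2_eq_square power3_eq_cube)
  have "h ^ 3 \<le> 6 * (3/2 * Q + P)"
  \<comment> \<open>9 = 6 * 3/2 is the threshold up to which the term \<open>Q\<close> alone
    suffices. Beyond it \<open>p\<close> is short, so both factors of \<open>P\<close> are
    comparable to \<open>h\<close>.\<close>
  proof (cases "h \<le> 9 * n")
    case True
    then have "h * h\<^sup>2 \<le> (9 * n) * h\<^sup>2" by (intro mult_right_mono) auto
    then have "h ^ 3 \<le> 9 * Q" by (simp add: h3 Q_def)
    then show ?thesis using PQ by argo
  next
    case False
    then have "7/9 * h \<le> R - n" "8/9 * h \<le> R + n / 2" using nn by auto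
    then have "(7/9 * h)\<^sup>2 * (8/9 * h) \<le> P"
      unfolding P_def using nn by (intro mult_mono power_mono) auto
    also have "(7/9 * h)\<^sup>2 * (8/9 * h) = 392/729 * h ^ 3"
      by (simp add: power2_eq_square power3_eq_cube)
    finally have "392/729 * h ^ 3 \<le> P" .
    moreover have "0 \<le> h ^ 3" using nn by simp
    ultimately have "h ^ 3 \<le> 6 * P" by linarith
    then show ?thesis using PQ by simp
  qed
  then show ?thesis by (simp add: B h_def)
qed

text \<open>
  Uniform convexity of the cubed norm alone gives only the factor \<open>1/2\<close>; the hypothesis excludes
  the worst case, where \<open>p\<close> and \<open>z\<close> are on opposite sides of the origin.
\<close>

lemma cubic_bregman_ge_near:
  assumes "cubic_bregman p z \<le> 103/100 * norm z ^ 3"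
  shows "25/36 * norm (z - p) ^ 3 \<le> cubic_bregman p z"
proof -
  define n R h where "n = norm p" and "R = norm z" and "h = norm (z - p)"
  have nn: "n \<ge> 0" "R \<ge> 0" "h \<ge> 0" "h \<le> R + n"
    using norm_triangle_ineq4[of z p] by (auto simp: n_def R_def h_def)
  have B: "cubic_bregman p z = 3/2 * n * h\<^sup>2 + (R - n)\<^sup>2 * (R + n / 2)"
    by (simp add: cubic_bregman_eq n_def R_def h_def)
  show ?thesis
  proof (cases "h \<le> R")
    case True
    \<comment> \<open>As a function of \<open>n\<close>, the distance is R^3 + n^3/2 - 3/2 n q^2,
      minimal at n = q with value R^3 - q^3 \<ge> h^3. So this case even gives the factor 1.\<close>
    define q where "q = sqrt (R\<^sup>2 - h\<^sup>2)"
    have q: "q \<ge> 0" "q\<^sup>2 = R\<^sup>2 - h\<^sup>2" using power_mono[OF True nn(3), of 2] by (simp_all add: q_def)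
    have "q \<le> R" by (rule power2_le_imp_le) (simp_all add: q(2) nn(2))
    have "h * h\<^sup>2 \<le> R * h\<^sup>2" "q * q\<^sup>2 \<le> R * q\<^sup>2"
      using True \<open>q \<le> R\<close> by (auto intro!: mult_right_mono)
    moreover have "R * h\<^sup>2 + R * q\<^sup>2 = R ^ 3"
      unfolding q(2) by (simp add: power2_eq_square power3_eq_cube algebra_simps
          add_divide_distrib diff_divide_distrib)
    ultimately have "h ^ 3 + q ^ 3 \<le> R ^ 3" by (simp add: power2_eq_square power3_eq_cube)
    moreover have "3/2 * n * h\<^sup>2 + (R - n)\<^sup>2 * (R + n / 2) = R ^ 3 + n ^ 3 / 2 - 3/2 * n * q\<^sup>2"
      unfolding q(2) by (simp add: power2_eq_square power3_eq_cube algebra_simps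
          add_divide_distrib diff_divide_distrib)
    moreover have "0 \<le> (n - q)\<^sup>2 * (n + 2 * q) / 2" using nn q by simp
    moreover have "(n - q)\<^sup>2 * (n + 2 * q) / 2 = n ^ 3 / 2 + q ^ 3 - 3/2 * n * q\<^sup>2"
      by (simp add: power2_eq_square power3_eq_cube algebra_simps
          add_divide_distrib diff_divide_distrib)
    ultimately have "h ^ 3 \<le> cubic_bregman p z" unfolding B by linarith
    moreover have "0 \<le> h ^ 3" using nn by simp
    ultimately show ?thesis unfolding h_def[symmetric] by linarith
  next
    case False
    have "R \<noteq> 0"
    proof
      assume "R = 0"
      then have "z = 0" by (simp add: R_def)
      then have "n ^ 3 * 2 \<le> 0" using assms by (simp add: cubic_bregman_eq n_def power2_eq_square power3_eq_cube)
      then have "n \<le> 0" using zero_less_power[of n 3] by linarith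
      then show False using False nn \<open>R = 0\<close> by simp
    qed
    then have R: "R > 0" using nn by simp
    have hR: "h\<^sup>2 - R\<^sup>2 \<ge> 0" using False power_mono[of R h 2] nn by simp
    have "2 * (R * (h - R)\<^sup>2) \<le> (h - R)\<^sup>2 * (h + R)"
      using False mult_left_mono[of "2 * R" "h + R" "(h - R)\<^sup>2"] by (simp add: mult_ac)
    also have "\<dots> = (h - R) * (h\<^sup>2 - R\<^sup>2)"
      by (simp add: power2_eq_square algebra_simps)
    also have "\<dots> \<le> n * (h\<^sup>2 - R\<^sup>2)"
      using nn hR by (intro mult_right_mono) auto
    finally have "2 * (R * (h - R)\<^sup>2) \<le> n * (h\<^sup>2 - R\<^sup>2)" .
    moreover have "cubic_bregman p z = R ^ 3 + n ^ 3 / 2 + 3/2 * (n * (h\<^sup>2 - R\<^sup>2))"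
      unfolding B by (simp add: power2_eq_square power3_eq_cube algebra_simps
          add_divide_distrib diff_divide_distrib)
    moreover have "0 \<le> n ^ 3 / 2" using nn by simp
    \<comment> \<open>The hypothesis leaves an excess of 3/100 R^3 = 3 R (R/10)^2 over R^3, whence h
      \<le> 11/10 R; and 25/36 * 1331/1000 < 1.\<close>
    ultimately have lo: "R ^ 3 + 3 * (R * (h - R)\<^sup>2) \<le> cubic_bregman p z"
      by argo
    then have "R * (h - R)\<^sup>2 \<le> R * (R / 10)\<^sup>2"
      using assms by (simp add: R_def power2_eq_square power3_eq_cube)
    then have "(h - R)\<^sup>2 \<le> (R / 10)\<^sup>2" using R by simp
    then have "h - R \<le> R / 10" using R by (intro power2_le_imp_le[of "h - R"]) auto
    then have "h ^ 3 \<le> (11/10 * R) ^ 3" using nn by (intro power_mono) auto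
    moreover have "0 \<le> 3 * (R * (h - R)\<^sup>2)" "0 \<le> R ^ 3" using R by auto
    moreover have "(11/10 * R) ^ 3 = 1331/1000 * R ^ 3" by (simp add: power_mult_distrib power_divide)
    ultimately show ?thesis using lo unfolding h_def[symmetric] by linarith
  qed
qed

subsection \<open>Convex functions with Lipschitz Hessian\<close>

text \<open>First-order optimality in a form shared by \<open>f\<close>, the cubic model and the
  estimating functions: an upper bound with quadratic remainder along each ray is enough. Testing
  with w = -p gives the result.\<close>

lemma eq_zero_if_first_order_nonneg:
  fixes p :: "'a::real_inner"
  assumes "\<And>w. \<exists>K. \<forall>t. 0 < t \<and> t \<le> 1 \<longrightarrow> 0 \<le> t * (p \<bullet> w) + K * t\<^sup>2"
  shows "p = 0"
proof -
  obtain K where K: "\<And>t. 0 < t \<Longrightarrow> t \<le> 1 \<Longrightarrow> 0 \<le> t * (p \<bullet> (- p)) + K * t\<^sup>2"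
    using assms[of "- p"] by blast
  have "p \<bullet> p \<le> 0"
  proof (rule nonpos_if_le_linear)
    fix t :: real assume t: "0 < t" "t \<le> 1"
    have "t * (p \<bullet> p) \<le> t * (K * t)"
      using K[OF t] by (simp add: power2_eq_square mult_ac)
    then show "p \<bullet> p \<le> K * t" using t by simp
  qed
  then show ?thesis by (simp add: inner_gt_zero_iff flip: not_less)
qed

lemma is_minimizer_le: "is_minimizer g z \<Longrightarrow> g z \<le> g w"
  by (auto simp: is_arg_min_def not_less)

locale convex_lipschitz_hessian =
  fixes f :: "real ^ 'n \<Rightarrow> real" and L :: real
  assumes convex: "convex_on UNIV f"
    and twice_diff: "twice_differentiable f"
    and L_pos: "L > 0"
    and hessian_lipschitz: "matrix_opnorm (hessian f u - hessian f v) \<le> L * norm (u - v)"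
begin

lemma has_derivative_f: "(f has_derivative (\<lambda>v. grad f x \<bullet> v)) (at x)"
proof -
  have "f differentiable (at x)"
    using twice_diff by (auto simp: twice_differentiable_def differentiable_on_def)
  then obtain f' where f': "(f has_derivative f') (at x)"
    by (auto simp: differentiable_def)
  then have lin: "linear f'"
    by (simp add: bounded_linear.linear has_derivative_bounded_linear)
  \<comment> \<open>The Riesz representative of the functional \<open>f'\<close>.\<close>
  define D where "D = adjoint f' 1"
  have "f' = (\<lambda>h. h \<bullet> D)"
    using adjoint_works[OF lin, of _ 1] by (auto simp: D_def)
  then have D: "GDERIV f x :> D" using f' by (simp add: gderiv_def)
  have "GDERIV f x :> grad f x"
    unfolding grad_def
  proof (rule theI[of "\<lambda>D. GDERIV f x :> D", OF D])
    fix E assume "GDERIV f x :> E"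
    then have "(\<lambda>h. h \<bullet> E) = (\<lambda>h. h \<bullet> D)"
      using D unfolding gderiv_def by (rule has_derivative_unique)
    then show "E = D" by (metis inner_commute vector_eq_ldot)
  qed
  then show ?thesis by (simp add: gderiv_def inner_commute)
qed

lemma has_derivative_grad: "(grad f has_derivative (\<lambda>v. hessian f x *v v)) (at x)"
proof -
  have "grad f differentiable (at x)"
    using twice_diff by (auto simp: twice_differentiable_def differentiable_on_def)
  then show ?thesis by (simp add: jacobian_works hessian_def)
qed

lemma norm_hessian_diff_le:
  "norm ((hessian f u - hessian f v) *v w) \<le> L * norm (u - v) * norm w"
proof -
  have "norm ((hessian f u - hessian f v) *v w) \<le> matrix_opnorm (hessian f u - hessian f v) * norm w"
    unfolding matrix_opnorm_def by (rule onorm) simp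
  also have "\<dots> \<le> L * norm (u - v) * norm w"
    by (intro mult_right_mono hessian_lipschitz) auto
  finally show ?thesis .
qed

lemma grad_taylor:
  "norm (grad f (x + s) - grad f x - hessian f x *v s) \<le> L / 2 * (norm s)\<^sup>2"
proof -
  define e where "e = grad f (x + s) - grad f x - hessian f x *v s"
  \<comment> \<open>Pairing with the fixed final error \<open>e\<close> makes the vector estimate
    scalar; monotonicity of \<psi> then replaces integration along the segment.\<close>
  define \<psi> where "\<psi> t = (grad f (x + t *\<^sub>R s) - grad f x - t *\<^sub>R (hessian f x *v s)) \<bullet> e
      - L / 2 * t\<^sup>2 * (norm s)\<^sup>2 * norm e" for t :: real
  have "\<psi> 1 \<le> \<psi> 0"
  proof (rule DERIV_nonpos_imp_nonincreasing[of 0 1 \<psi>])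
    fix t :: real assume t: "0 \<le> t" "t \<le> 1"
    have "((\<lambda>t. grad f (x + t *\<^sub>R s)) has_derivative (\<lambda>h. hessian f (x + t *\<^sub>R s) *v (h *\<^sub>R s))) (at t)"
      by (rule has_derivative_compose[OF _ has_derivative_grad]) (auto intro!: derivative_eq_intros)
    then have "((\<lambda>t. (grad f (x + t *\<^sub>R s) - grad f x - t *\<^sub>R (hessian f x *v s)) \<bullet> e) has_derivative
        (\<lambda>h. (hessian f (x + t *\<^sub>R s) *v (h *\<^sub>R s) - h *\<^sub>R (hessian f x *v s)) \<bullet> e)) (at t)"
      by (auto intro!: derivative_eq_intros)
    then have "((\<lambda>t. (grad f (x + t *\<^sub>R s) - grad f x - t *\<^sub>R (hessian f x *v s)) \<bullet> e)
        has_real_derivative ((hessian f (x + t *\<^sub>R s) - hessian f x) *v s) \<bullet> e) (at t)"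
      by (rule has_derivative_imp_has_field_derivative)
        (simp add: matrix_vector_mult_scaleR matrix_vector_mult_diff_rdistrib inner_diff_left algebra_simps)
    then have d: "(\<psi> has_real_derivative ((hessian f (x + t *\<^sub>R s) - hessian f x) *v s) \<bullet> e
        - L * t * (norm s)\<^sup>2 * norm e) (at t)"
      unfolding \<psi>_def by (auto intro!: derivative_eq_intros)
    have "((hessian f (x + t *\<^sub>R s) - hessian f x) *v s) \<bullet> e
        \<le> norm ((hessian f (x + t *\<^sub>R s) - hessian f x) *v s) * norm e"
      by (rule norm_cauchy_schwarz)
    also have "\<dots> \<le> L * norm (t *\<^sub>R s) * norm s * norm e"
      using norm_hessian_diff_le[of "x + t *\<^sub>R s" x s] by (intro mult_right_mono) auto
    also have "\<dots> = L * t * (norm s)\<^sup>2 * norm e"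
      using t by (simp add: power2_eq_square)
    finally show "\<exists>y. (\<psi> has_real_derivative y) (at t) \<and> y \<le> 0"
      using d by (intro exI conjI) auto
  qed simp
  then have "e \<bullet> e \<le> L / 2 * (norm s)\<^sup>2 * norm e"
    by (simp add: \<psi>_def e_def)
  then have "norm e * norm e \<le> (L / 2 * (norm s)\<^sup>2) * norm e"
    by (simp add: power2_norm_eq_inner[symmetric] power2_eq_square)
  then show ?thesis
    using L_pos by (cases "norm e = 0") (auto simp: e_def[symmetric])
qed

lemma taylor:
  "\<bar>f (x + s) - f x - grad f x \<bullet> s - 1/2 * ((hessian f x *v s) \<bullet> s)\<bar> \<le> L / 6 * norm s ^ 3"
proof -
  define R where "R t = f (x + t *\<^sub>R s) - f x - t * (grad f x \<bullet> s) - t\<^sup>2 / 2 * ((hessian f x *v s) \<bullet> s)" for t :: real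
  define R' where "R' t = (grad f (x + t *\<^sub>R s) - grad f x - hessian f x *v (t *\<^sub>R s)) \<bullet> s" for t :: real
  have R: "(R has_real_derivative R' t) (at t)" for t
  proof -
    have "((\<lambda>t. f (x + t *\<^sub>R s)) has_derivative (\<lambda>h. grad f (x + t *\<^sub>R s) \<bullet> (h *\<^sub>R s))) (at t)"
      by (rule has_derivative_compose[OF _ has_derivative_f]) (auto intro!: derivative_eq_intros)
    then have "((\<lambda>t. f (x + t *\<^sub>R s)) has_real_derivative grad f (x + t *\<^sub>R s) \<bullet> s) (at t)"
      by (rule has_derivative_imp_has_field_derivative) simp
    then show ?thesis
      unfolding R_def R'_def
      by (auto intro!: derivative_eq_intros simp: matrix_vector_mult_scaleR inner_diff_left)
  qed
  have R': "\<bar>R' t\<bar> \<le> L / 2 * t\<^sup>2 * norm s ^ 3" for t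
  proof -
    have "\<bar>R' t\<bar> \<le> norm (grad f (x + t *\<^sub>R s) - grad f x - hessian f x *v (t *\<^sub>R s)) * norm s"
      unfolding R'_def by (rule Cauchy_Schwarz_ineq2)
    also have "\<dots> \<le> L / 2 * (norm (t *\<^sub>R s))\<^sup>2 * norm s"
      by (intro mult_right_mono grad_taylor) auto
    finally show ?thesis by (simp add: power_mult_distrib power3_eq_cube) (simp add: power2_eq_square mult_ac)
  qed
  \<comment> \<open>The sign \<sigma> treats both directions of the absolute value at once.\<close>
  have aux: "\<sigma> * R 1 - L / 6 * norm s ^ 3 \<le> 0" if "\<bar>\<sigma>\<bar> = 1" for \<sigma> :: real
  proof -
    have "\<sigma> * R 1 - L / 6 * 1 ^ 3 * norm s ^ 3 \<le> \<sigma> * R 0 - L / 6 * 0 ^ 3 * norm s ^ 3"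
    proof (rule DERIV_nonpos_imp_nonincreasing[of 0 1 "\<lambda>t. \<sigma> * R t - L / 6 * t ^ 3 * norm s ^ 3"])
      fix t :: real
      have "((\<lambda>t. \<sigma> * R t - L / 6 * t ^ 3 * norm s ^ 3) has_real_derivative
          \<sigma> * R' t - L / 2 * t\<^sup>2 * norm s ^ 3) (at t)"
        by (auto intro!: derivative_eq_intros R)
      moreover have "\<sigma> * R' t \<le> \<bar>\<sigma> * R' t\<bar>" by (rule abs_ge_self)
      then have "\<sigma> * R' t - L / 2 * t\<^sup>2 * norm s ^ 3 \<le> 0"
        using R'[of t] that by (simp add: abs_mult)
      ultimately show "\<exists>y. ((\<lambda>t. \<sigma> * R t - L / 6 * t ^ 3 * norm s ^ 3) has_real_derivative y) (at t) \<and> y \<le> 0"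
        by blast
    qed simp
    then show ?thesis by (simp add: R_def)
  qed
  have "\<bar>R 1\<bar> \<le> L / 6 * norm s ^ 3" using aux[of 1] aux[of "-1"] by simp
  then show ?thesis by (simp add: R_def)
qed

lemma taylor_ray:
  assumes "t \<ge> 0"
  shows "f (x + t *\<^sub>R s) \<le> f x + t * (grad f x \<bullet> s) + t\<^sup>2 * ((hessian f x *v s) \<bullet> s / 2)
      + t ^ 3 * (L / 6 * norm s ^ 3)"
    and "f x + t * (grad f x \<bullet> s) + t\<^sup>2 * ((hessian f x *v s) \<bullet> s / 2)
      - t ^ 3 * (L / 6 * norm s ^ 3) \<le> f (x + t *\<^sub>R s)"
proof -
  have "\<bar>f (x + t *\<^sub>R s) - f x - t * (grad f x \<bullet> s) - t\<^sup>2 * ((hessian f x *v s) \<bullet> s / 2)\<bar>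
      \<le> t ^ 3 * (L / 6 * norm s ^ 3)"
    using taylor[of x "t *\<^sub>R s"] assms
    by (simp add: matrix_vector_mult_scaleR power_mult_distrib power2_eq_square mult_ac)
  then show "f (x + t *\<^sub>R s) \<le> f x + t * (grad f x \<bullet> s) + t\<^sup>2 * ((hessian f x *v s) \<bullet> s / 2)
      + t ^ 3 * (L / 6 * norm s ^ 3)"
    and "f x + t * (grad f x \<bullet> s) + t\<^sup>2 * ((hessian f x *v s) \<bullet> s / 2)
      - t ^ 3 * (L / 6 * norm s ^ 3) \<le> f (x + t *\<^sub>R s)"
    by linarith+
qed

lemma tangent_le: "f x + grad f x \<bullet> s \<le> f (x + s)"
proof -
  define c where "c = (hessian f x *v s) \<bullet> s"
  have "grad f x \<bullet> s - (f (x + s) - f x) \<le> 0"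
  proof (rule nonpos_if_le_linear)
    fix t :: real assume t: "0 < t" "t \<le> 1"
    have "f (x + t *\<^sub>R s) = f ((1 - t) *\<^sub>R x + t *\<^sub>R (x + s))"
      by (simp add: algebra_simps)
    also have "\<dots> \<le> (1 - t) * f x + t * f (x + s)"
      using convex t by (intro convex_onD) auto
    finally have "f (x + t *\<^sub>R s) \<le> (1 - t) * f x + t * f (x + s)" .
    moreover have "f (x + t *\<^sub>R s) \<ge> f x + t * (grad f x \<bullet> s) + t * (t * c / 2) - t * (t\<^sup>2 * (L / 6 * norm s ^ 3))"
      using taylor_ray(2)[of t x s] t by (simp add: c_def power2_eq_square power3_eq_cube mult_ac)
    ultimately have "t * (grad f x \<bullet> s - (f (x + s) - f x)) \<le> t * (t\<^sup>2 * (L / 6 * norm s ^ 3) - t * c / 2)"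
      by (simp add: algebra_simps)
    then have "grad f x \<bullet> s - (f (x + s) - f x) \<le> t\<^sup>2 * (L / 6 * norm s ^ 3) - t * c / 2"
      using t by simp
    also have "t\<^sup>2 * (L / 6 * norm s ^ 3) \<le> t * (L / 6 * norm s ^ 3)"
      using t L_pos by (intro mult_right_mono) (auto simp: power2_eq_square mult_le_one)
    finally show "grad f x \<bullet> s - (f (x + s) - f x) \<le> (L / 6 * norm s ^ 3 - c / 2) * t"
      by (simp add: algebra_simps)
  qed
  then show ?thesis by simp
qed

text \<open>Compare the tangent bound with the Taylor expansion at order t^2.\<close>

lemma hessian_psd: "0 \<le> (hessian f x *v s) \<bullet> s"
proof -
  define c where "c = (hessian f x *v s) \<bullet> s"
  have "- c \<le> 0"
  proof (rule nonpos_if_le_linear)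
    fix t :: real assume t: "0 < t" "t \<le> 1"
    have "t\<^sup>2 * (- c) \<le> t\<^sup>2 * (L / 3 * norm s ^ 3 * t)"
      using taylor_ray(1)[of t x s] tangent_le[of x "t *\<^sub>R s"] t
      by (simp add: c_def power2_eq_square power3_eq_cube algebra_simps)
    then show "- c \<le> L / 3 * norm s ^ 3 * t"
      using t by (simp only: mult_le_cancel_left_pos zero_less_power)
  qed
  then show ?thesis by (simp add: c_def)
qed

text \<open>Expand f(x + t(u + v)) directly and through x + tu: at order t^2 the expansions differ
  by (a - b)/2, which gives one inequality, and exchanging \<open>u\<close> and \<open>v\<close> the
  other. Symmetry is what makes \<open>hessian f x *v s\<close> the gradient of the quadratic term
  of the model.\<close>

lemma hessian_symmetric: "(hessian f x *v u) \<bullet> v = (hessian f x *v v) \<bullet> u"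
proof -
  have "(hessian f x *v u) \<bullet> v - (hessian f x *v v) \<bullet> u \<le> 0" for u v
  proof -
    define a where "a = (hessian f x *v u) \<bullet> v"
    define b where "b = (hessian f x *v v) \<bullet> u"
    define c where "c = (hessian f x *v v) \<bullet> v"
    define d where "d = (hessian f x *v u) \<bullet> u"
    define K where "K = L / 6 * norm (u + v) ^ 3 + L / 6 * norm u ^ 3 + L / 6 * norm v ^ 3
      + L / 2 * (norm u)\<^sup>2 * norm v + L / 2 * norm u * (norm v)\<^sup>2"
    have "a - b \<le> 0"
    proof (rule nonpos_if_le_linear)
      fix t :: real assume t: "0 < t" "t \<le> 1"
      define G where "G = grad f (x + t *\<^sub>R u) \<bullet> v"
      define C where "C = (hessian f (x + t *\<^sub>R u) *v v) \<bullet> v"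
      have "f (x + t *\<^sub>R (u + v)) \<le> f x + t * (grad f x \<bullet> u) + t * (grad f x \<bullet> v)
          + t\<^sup>2 * ((a + b + c + d) / 2) + t ^ 3 * (L / 6 * norm (u + v) ^ 3)"
        using taylor_ray(1)[of t x "u + v"] t
        by (simp add: matrix_vector_right_distrib inner_add a_def b_def c_def d_def distrib_left add_ac)
      moreover have "f (x + t *\<^sub>R u) \<ge> f x + t * (grad f x \<bullet> u) + t\<^sup>2 * (d / 2) - t ^ 3 * (L / 6 * norm u ^ 3)"
        using taylor_ray(2)[of t x u] t by (simp add: d_def)
      moreover have "f (x + t *\<^sub>R (u + v)) \<ge> f (x + t *\<^sub>R u) + t * G + t\<^sup>2 * (C / 2) - t ^ 3 * (L / 6 * norm v ^ 3)"
        using taylor_ray(2)[of t "x + t *\<^sub>R u" v] t by (simp add: G_def C_def scaleR_add_right add_ac)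
      moreover have "t * G \<ge> t * (grad f x \<bullet> v + t * a - t\<^sup>2 * (L / 2 * (norm u)\<^sup>2 * norm v))"
      proof -
        have "- ((grad f (x + t *\<^sub>R u) - grad f x - hessian f x *v (t *\<^sub>R u)) \<bullet> v)
            \<le> norm (grad f (x + t *\<^sub>R u) - grad f x - hessian f x *v (t *\<^sub>R u)) * norm v"
          using Cauchy_Schwarz_ineq2[of "grad f (x + t *\<^sub>R u) - grad f x - hessian f x *v (t *\<^sub>R u)" v]
          by linarith
        also have "\<dots> \<le> L / 2 * (norm (t *\<^sub>R u))\<^sup>2 * norm v"
          by (intro mult_right_mono grad_taylor) auto
        finally have "G \<ge> grad f x \<bullet> v + t * a - t\<^sup>2 * (L / 2 * (norm u)\<^sup>2 * norm v)"
          by (simp add: G_def a_def inner_diff_left matrix_vector_mult_scaleR power_mult_distrib mult_ac)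
        then show ?thesis using t by (intro mult_left_mono) auto
      qed
      moreover have "t\<^sup>2 * (C / 2) \<ge> t\<^sup>2 * (c / 2 - t * (L / 2 * norm u * (norm v)\<^sup>2))"
      proof -
        have "- (((hessian f (x + t *\<^sub>R u) - hessian f x) *v v) \<bullet> v)
            \<le> norm ((hessian f (x + t *\<^sub>R u) - hessian f x) *v v) * norm v"
          using Cauchy_Schwarz_ineq2[of "(hessian f (x + t *\<^sub>R u) - hessian f x) *v v" v] by linarith
        also have "\<dots> \<le> L * norm (t *\<^sub>R u) * norm v * norm v"
          using norm_hessian_diff_le[of "x + t *\<^sub>R u" x v] by (intro mult_right_mono) auto
        finally have "C \<ge> c - t * (L * norm u * (norm v)\<^sup>2)"
          using t by (simp add: C_def c_def inner_diff_left matrix_vector_mult_diff_rdistrib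
              power2_eq_square mult_ac)
        then have "C / 2 \<ge> c / 2 - t * (L / 2 * norm u * (norm v)\<^sup>2)" by simp
        then show ?thesis by (intro mult_left_mono) auto
      qed
      ultimately have "t\<^sup>2 * ((a - b) / 2) \<le> t\<^sup>2 * (K * t)"
        unfolding K_def by (simp add: algebra_simps power2_eq_square power3_eq_cube add_divide_distrib diff_divide_distrib)
      then have "(a - b) / 2 \<le> K * t" using t by simp
      then show "a - b \<le> (2 * K) * t" by simp
    qed
    then show ?thesis by (simp add: a_def b_def)
  qed
  from this[of u v] this[of v u] show ?thesis by simp
qed

subsection \<open>Cubic Newton steps\<close>

lemma grad_eq_zero_if_minimizer:
  assumes "is_minimizer f z"
  shows "grad f z = 0"
proof (rule eq_zero_if_first_order_nonneg)
  fix w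
  define K where "K = (hessian f z *v w) \<bullet> w / 2 + L / 6 * norm w ^ 3"
  have "0 \<le> t * (grad f z \<bullet> w) + K * t\<^sup>2" if t: "0 < t" "t \<le> 1" for t
  proof -
    have "t ^ 3 \<le> t\<^sup>2" using t by (intro power_decreasing) auto
    then have "t ^ 3 * (L / 6 * norm w ^ 3) \<le> t\<^sup>2 * (L / 6 * norm w ^ 3)"
      using L_pos by (intro mult_right_mono) auto
    then show ?thesis
      using taylor_ray(1)[of t z w] is_minimizer_le[OF assms, of "z + t *\<^sub>R w"] t
      by (simp add: K_def algebra_simps)
  qed
  then show "\<exists>K. \<forall>t. 0 < t \<and> t \<le> 1 \<longrightarrow> 0 \<le> t * (grad f z \<bullet> w) + K * t\<^sup>2" by blast
qed

lemma cubic_step_stationary: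
  assumes step: "cubic_step f M x z" and M: "M \<ge> 0"
  shows "grad f x + hessian f x *v (z - x) + (M / 2 * norm (z - x)) *\<^sub>R (z - x) = 0"
proof (rule eq_zero_if_first_order_nonneg)
  fix w
  define s where "s = z - x"
  define p where "p = grad f x + hessian f x *v s + (M / 2 * norm s) *\<^sub>R s"
  define K where "K = (hessian f x *v w) \<bullet> w / 2 + M / 6 * (3 * norm s * (norm w)\<^sup>2 + norm w ^ 3)"
  have "0 \<le> t * (p \<bullet> w) + K * t\<^sup>2" if t: "0 < t" "t \<le> 1" for t
  proof -
    have "cubic_model f M x z \<le> cubic_model f M x (x + (s + t *\<^sub>R w))"
      using step by (auto simp: cubic_step_def intro: is_minimizer_le)
    then have a: "0 \<le> t * (grad f x \<bullet> w) + t * ((hessian f x *v s) \<bullet> w)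
        + t\<^sup>2 * ((hessian f x *v w) \<bullet> w / 2) + M / 6 * (norm (s + t *\<^sub>R w) ^ 3 - norm s ^ 3)"
      using hessian_symmetric[of x w s]
      by (simp add: cubic_model_def s_def[symmetric] matrix_vector_right_distrib
          matrix_vector_mult_scaleR inner_add_left inner_add_right power2_eq_square algebra_simps)
    have "t ^ 3 \<le> t\<^sup>2" using t by (intro power_decreasing) auto
    then have b: "t ^ 3 * norm w ^ 3 \<le> t\<^sup>2 * norm w ^ 3" by (intro mult_right_mono) auto
    have "norm (s + t *\<^sub>R w) ^ 3 - norm s ^ 3
        \<le> t * (3 * norm s * (s \<bullet> w)) + t\<^sup>2 * (3 * norm s * (norm w)\<^sup>2 + norm w ^ 3)"
      using cubic_bregman_le[of s "t *\<^sub>R w"] b t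
      by (simp add: cubic_bregman_def power_mult_distrib algebra_simps)
    then have "M / 6 * (norm (s + t *\<^sub>R w) ^ 3 - norm s ^ 3)
        \<le> M / 6 * (t * (3 * norm s * (s \<bullet> w)) + t\<^sup>2 * (3 * norm s * (norm w)\<^sup>2 + norm w ^ 3))"
      using M by (intro mult_left_mono) auto
    with a show ?thesis
      by (simp add: p_def K_def inner_add_left algebra_simps)
  qed
  then show "\<exists>K. \<forall>t. 0 < t \<and> t \<le> 1 \<longrightarrow> 0 \<le> t * ((grad f x + hessian f x *v (z - x)
      + (M / 2 * norm (z - x)) *\<^sub>R (z - x)) \<bullet> w) + K * t\<^sup>2"
    unfolding p_def s_def by blast
qed

text \<open>By stationarity of the model, the vector on the left is the Taylor remainder of the
  gradient.\<close>

lemma cubic_step_grad: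
  assumes "cubic_step f M x z" and "M \<ge> 0"
  shows "norm (grad f z + (M / 2 * norm (z - x)) *\<^sub>R (z - x)) \<le> L / 2 * (norm (z - x))\<^sup>2"
proof -
  have eq: "grad f z + (M / 2 * norm (z - x)) *\<^sub>R (z - x)
      = grad f (x + (z - x)) - grad f x - hessian f x *v (z - x)"
    using cubic_step_stationary[OF assms] by (simp add: algebra_simps add_eq_0_iff)
  show ?thesis unfolding eq by (rule grad_taylor)
qed

text \<open>Squaring \<open>cubic_step_grad\<close> bounds 2 L r times the inner product below by
  \<parallel>g\<parallel>^2 + 3/4 L^2 r^4. After division by 2 L r, the bound is least at r =
  v.\<close>

lemma cubic_step_grad_inner:
  assumes step: "cubic_step f (2 * L) x z"
    and v: "v \<ge> 0" and G: "norm (grad f z) = 3/2 * L * v\<^sup>2"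
  shows "3/2 * L * v ^ 3 \<le> grad f z \<bullet> (x - z)"
proof -
  define g s r where "g = grad f z" and "s = z - x" and "r = norm s"
  show ?thesis
  proof (cases "r = 0")
    case True
    then have "norm g \<le> 0"
      using cubic_step_grad[OF step] L_pos by (simp add: g_def s_def r_def)
    then have "v\<^sup>2 \<le> 0" using G L_pos by (simp add: g_def mult_le_0_iff)
    then have "v = 0" by simp
    then show ?thesis using True by (simp add: s_def r_def)
  next
    case False
    then have r: "r > 0" by (simp add: r_def)
    have expand: "(norm (g + c *\<^sub>R s))\<^sup>2 = (norm g)\<^sup>2 + 2 * c * (g \<bullet> s) + c\<^sup>2 * (norm s)\<^sup>2" for c
      unfolding power2_norm_eq_inner
      by (simp add: inner_add_left inner_add_right inner_commute power2_eq_square)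
    have "(norm (g + (L * r) *\<^sub>R s))\<^sup>2 \<le> (L / 2 * r\<^sup>2)\<^sup>2"
      using cubic_step_grad[OF step] L_pos by (intro power_mono) (auto simp: g_def s_def r_def)
    also have "(norm (g + (L * r) *\<^sub>R s))\<^sup>2 = (norm g)\<^sup>2 + 2 * L * r * (g \<bullet> s) + (L * r)\<^sup>2 * r\<^sup>2"
      using expand[of "L * r"] by (simp add: r_def)
    finally have "(3/2 * L * v\<^sup>2)\<^sup>2 + 3/4 * (L * r)\<^sup>2 * r\<^sup>2 \<le> L * r * (2 * (g \<bullet> (x - z)))"
      by (simp add: G[folded g_def] s_def power_mult_distrib power2_eq_square inner_diff_right algebra_simps)
    moreover have "L * r * (3 * L * v ^ 3) \<le> (3/2 * L * v\<^sup>2)\<^sup>2 + 3/4 * (L * r)\<^sup>2 * r\<^sup>2"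
    proof -
      have "0 \<le> 3/4 * L\<^sup>2 * ((v - r)\<^sup>2 * ((r + v)\<^sup>2 + 2 * v\<^sup>2))" by simp
      also have "\<dots> = (3/2 * L * v\<^sup>2)\<^sup>2 + 3/4 * (L * r)\<^sup>2 * r\<^sup>2 - L * r * (3 * L * v ^ 3)"
        by (simp add: power2_eq_square power3_eq_cube algebra_simps)
      finally show ?thesis by simp
    qed
    ultimately have "L * r * (3 * L * v ^ 3) \<le> L * r * (2 * (g \<bullet> (x - z)))" by linarith
    then show ?thesis using r L_pos by (simp add: g_def)
  qed
qed

text \<open>With M = L the model majorizes \<open>f\<close>. It exceeds \<open>f\<close> by at most
  L/6 from Taylor plus L/6 from the regularizer.\<close>

lemma cubic_step_le:
  assumes "cubic_step f L x z"
  shows "f z \<le> f w + L / 3 * norm (w - x) ^ 3"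
proof -
  have "f z \<le> cubic_model f L x z"
    using taylor_ray(1)[of 1 x "z - x"] by (simp add: cubic_model_def)
  also have "\<dots> \<le> cubic_model f L x w"
    using assms by (auto simp: cubic_step_def intro: is_minimizer_le)
  also have "\<dots> \<le> f w + L / 3 * norm (w - x) ^ 3"
    using taylor_ray(2)[of 1 x "w - x"] by (simp add: cubic_model_def)
  finally show ?thesis .
qed

lemma cubic_step_norm_le:
  assumes step: "cubic_step f L x z" and w: "grad f w = 0"
  shows "norm (z - x) \<le> 2 * norm (x - w)"
proof (rule ccontr)
  define s d r R where "s = z - x" and "d = x - w" and "r = norm s" and "R = norm d"
  \<comment> \<open>Up to sign, \<open>e\<close> is the gradient's Taylor remainder from
    \<open>x\<close> to \<open>w\<close>, since the gradient vanishes at \<open>w\<close>. Pairing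
    stationarity with s + d = z - w and dropping the nonnegative Hessian term gives r^2 (r - R)
    \<le> R^2 (r + R), impossible for r > 2R.\<close>
  define e where "e = grad f x - hessian f x *v d"
  assume "\<not> norm (z - x) \<le> 2 * norm (x - w)"
  then have r: "r > 2 * R" "R \<ge> 0" by (auto simp: r_def R_def s_def d_def)
  have "- e = grad f (x + - d) - grad f x - hessian f x *v (- d)"
    using w by (simp add: e_def d_def matrix_vector_mult_diff_distrib)
  then have "norm (- e) \<le> L / 2 * R\<^sup>2"
    using grad_taylor[of x "- d"] by (simp only: R_def norm_minus_cancel)
  then have e: "norm e \<le> L / 2 * R\<^sup>2" by simp
  have "hessian f x *v (s + d) + e + (L / 2 * r) *\<^sub>R s = 0"
    using cubic_step_stationary[OF step] L_pos
    by (simp add: e_def s_def r_def matrix_vector_right_distrib algebra_simps)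
  then have "(hessian f x *v (s + d) + e + (L / 2 * r) *\<^sub>R s) \<bullet> (s + d) = 0" by simp
  then have "(L / 2 * r) * (s \<bullet> (s + d)) \<le> - (e \<bullet> (s + d))"
    using hessian_psd[of x "s + d"] by (simp add: inner_add_left)
  also have "\<dots> \<le> norm e * norm (s + d)"
    using Cauchy_Schwarz_ineq2[of e "s + d"] by linarith
  also have "\<dots> \<le> (L / 2 * R\<^sup>2) * (r + R)"
    unfolding r_def R_def using L_pos e by (intro mult_mono norm_triangle_ineq) (auto simp: R_def)
  finally have "L / 2 * (r * (s \<bullet> (s + d))) \<le> L / 2 * (R\<^sup>2 * (r + R))" by (simp add: mult_ac)
  then have 1: "r * (s \<bullet> (s + d)) \<le> R\<^sup>2 * (r + R)" using L_pos by simp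
  have "s \<bullet> (s + d) \<ge> r * r - r * R"
    using Cauchy_Schwarz_ineq2[of s d]
    by (simp add: inner_add_right r_def R_def power2_norm_eq_inner[symmetric] power2_eq_square[symmetric])
  then have "r * (r * r - r * R) \<le> r * (s \<bullet> (s + d))" using r by (intro mult_left_mono) auto
  with 1 have 2: "r\<^sup>2 * (r - R) \<le> R\<^sup>2 * (r + R)" by (simp add: power2_eq_square algebra_simps)
  have "(2 * R)\<^sup>2 \<le> r\<^sup>2" using r by (intro power_mono) auto
  then have "4 * R\<^sup>2 * (r - R) \<le> r\<^sup>2 * (r - R)"
    using r by (intro mult_right_mono) (auto simp: power_mult_distrib)
  with 2 have 3: "R\<^sup>2 * (3 * r - 5 * R) \<le> 0" by (simp add: algebra_simps)
  show False
  proof (cases "R = 0")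
    case True
    then show False using 2 r by (simp add: power2_eq_square mult_le_0_iff)
  next
    case False
    then have "R\<^sup>2 * (3 * r - 5 * R) > 0" using r by (intro mult_pos_pos) auto
    then show False using 3 by simp
  qed
qed

end

subsection \<open>Estimating functions\<close>

text \<open>Affine functions have zero Bregman distance and the gradient vanishes at \<nu>, so the
  growth of \<phi> is given by an equality. The last step of the main proof exploits the exact
  value, not just a convexity bound.\<close>

lemma cubic_affine_minimizer:
  fixes b x0 \<nu> z :: "real ^ 'n"
  assumes \<phi>: "\<phi> = (\<lambda>z. \<beta> + b \<bullet> z + C / 6 * norm (z - x0) ^ 3)"
    and min: "is_minimizer \<phi> \<nu>" and C: "C \<ge> 0"
  shows "\<phi> z = \<phi> \<nu> + C / 6 * cubic_bregman (\<nu> - x0) (z - x0)"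
proof -
  define n where "n = norm (\<nu> - x0)"
  have "b + (C / 2 * n) *\<^sub>R (\<nu> - x0) = 0"
  proof (rule eq_zero_if_first_order_nonneg)
    fix w :: "real ^ 'n"
    define K where "K = C / 6 * (3 * n * (norm w)\<^sup>2 + norm w ^ 3)"
    have "0 \<le> t * ((b + (C / 2 * n) *\<^sub>R (\<nu> - x0)) \<bullet> w) + K * t\<^sup>2" if t: "0 < t" "t \<le> 1" for t
    proof -
      have e: "\<nu> + t *\<^sub>R w - x0 = (\<nu> - x0) + t *\<^sub>R w" by simp
      have a: "0 \<le> t * (b \<bullet> w) + C / 6 * (norm ((\<nu> - x0) + t *\<^sub>R w) ^ 3 - n ^ 3)"
        using is_minimizer_le[OF min, of "\<nu> + t *\<^sub>R w"]
        unfolding \<phi> e n_def by (simp add: inner_add_right algebra_simps)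
      have "t ^ 3 \<le> t\<^sup>2" using t by (intro power_decreasing) auto
      then have b: "t ^ 3 * norm w ^ 3 \<le> t\<^sup>2 * norm w ^ 3" by (intro mult_right_mono) auto
      have "norm ((\<nu> - x0) + t *\<^sub>R w) ^ 3 - n ^ 3
          \<le> t * (3 * n * ((\<nu> - x0) \<bullet> w)) + t\<^sup>2 * (3 * n * (norm w)\<^sup>2 + norm w ^ 3)"
        using cubic_bregman_le[of "\<nu> - x0" "t *\<^sub>R w"] b t
        by (simp add: cubic_bregman_def power_mult_distrib n_def[symmetric] algebra_simps)
      then have "C / 6 * (norm ((\<nu> - x0) + t *\<^sub>R w) ^ 3 - n ^ 3)
          \<le> C / 6 * (t * (3 * n * ((\<nu> - x0) \<bullet> w)) + t\<^sup>2 * (3 * n * (norm w)\<^sup>2 + norm w ^ 3))"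
        using C by (intro mult_left_mono) auto
      with a show ?thesis by (simp add: K_def inner_add_left algebra_simps)
    qed
    then show "\<exists>K. \<forall>t. 0 < t \<and> t \<le> 1 \<longrightarrow> 0 \<le> t * ((b + (C / 2 * n) *\<^sub>R (\<nu> - x0)) \<bullet> w) + K * t\<^sup>2"
      by blast
  qed
  then have "b = (- (C / 2 * n)) *\<^sub>R (\<nu> - x0)" by (simp add: eq_neg_iff_add_eq_0)
  moreover define q where "q = (\<nu> - x0) \<bullet> (z - \<nu>)"
  ultimately have "b \<bullet> (z - \<nu>) = - (C / 2 * n) * q" by simp
  then have "b \<bullet> z = b \<bullet> \<nu> - C / 2 * n * q" by (simp add: inner_diff_right)
  moreover have "cubic_bregman (\<nu> - x0) (z - x0) = norm (z - x0) ^ 3 - n ^ 3 - 3 * n * q"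
    by (simp add: cubic_bregman_def n_def q_def)
  ultimately show ?thesis by (simp add: \<phi> n_def right_diff_distrib)
qed

theorem lemma2p1:
  fixes f :: "real ^ 'n \<Rightarrow> real"
    and L :: real
    and x :: "nat \<Rightarrow> real ^ 'n"
    and xstar :: "real ^ 'n"
    and k :: nat
  assumes "convex_on UNIV f"
    and "twice_differentiable f"
    and "L > 0"
    and "\<forall>u v. matrix_opnorm (hessian f u - hessian f v) \<le> L * norm (u - v)"
    and "is_minimizer f xstar"
    and "modified_accelerated_cubic_newton f L
           (2 * L)
           (12 * L / (sqrt 2 - 1)\<^sup>2)
           (\<lambda>j. (real j + 1) * (real j + 2) / 2)
           1 x"
    and "k \<ge> 1"
  shows "f (x k) - f xstar + 1 / sqrt (3 * L) * norm (grad f (x k)) powr (3/2)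
           \<le> 80 * L * norm (x 0 - xstar) ^ 3 / (real k * (real k + 1) * (real k + 2))"
proof -

  \<comment> \<open>Constants and unfolding of the run\<close>
  interpret convex_lipschitz_hessian f L
    using assms(1-4) by unfold_locales auto
  define C where "C = 12 * L / (sqrt 2 - 1)\<^sup>2"
  define a where "a j = (real j + 1) * (real j + 2) / 2" for j :: nat
  define v where "v j = sqrt (2 * norm (grad f (x j)) / (3 * L))" for j
  have v: "v j \<ge> 0" "norm (grad f (x j)) = 3/2 * L * (v j)\<^sup>2"
      "1 / sqrt (3 * L) * norm (grad f (x j)) powr (3/2) = 3/4 * sqrt 2 * L * v j ^ 3" for j
    unfolding v_def by (rule gradient_scale[OF L_pos norm_ge_zero])+
  define e where "e = 1 / sqrt (3 * L) * norm (grad f (x 1)) powr (3/2)"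
  define R where "R = norm (xstar - x 0)"
  have R: "R \<ge> 0" by (simp add: R_def)
  have sqrt2: "1414/1000 \<le> sqrt 2" "sqrt 2 \<le> 14143/10000"
    by (rule real_le_rsqrt real_le_lsqrt; simp add: power2_eq_square)+
  \<comment> \<open>The reciprocal of (sqrt 2 - 1)^2 is (sqrt 2 + 1)^2 = 3 + 2 sqrt 2.\<close>
  have C6: "C / 6 = 2 * L * (3 + 2 * sqrt 2)"
  proof -
    define q where "q = (sqrt 2 - 1)\<^sup>2"
    have "(3 + 2 * sqrt 2) * q = 1"
      by (simp add: q_def power2_eq_square algebra_simps)
    then have "12 * L = 12 * L * (3 + 2 * sqrt 2) * q" "q \<noteq> 0" by (auto simp: mult.assoc)
    then have "C = 12 * L * (3 + 2 * sqrt 2)" by (simp add: C_def q_def[symmetric] nonzero_divide_eq_eq)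
    then show ?thesis by simp
  qed
  have C: "11656/1000 * L \<le> C / 6" "C / 6 \<le> 11658/1000 * L"
    using mult_left_mono[OF sqrt2(1), of L] mult_left_mono[OF sqrt2(2), of L] L_pos
    unfolding C6 by (simp_all add: algebra_simps)
  obtain A \<phi> \<nu> y where
    step1: "cubic_step f L (x 0) (x 1)" and A1: "A 1 = 1" and
    \<phi>1: "\<phi> 1 = (\<lambda>z. f (x 1) + 1 / sqrt (L + 2 * L) * norm (grad f (x 1)) powr (3/2)
                      + C / 6 * norm (z - x 0) ^ 3)" and
    run: "\<forall>k\<ge>1. is_minimizer (\<phi> k) (\<nu> k) \<and> A (k + 1) = A k + a k \<and>
           (let \<alpha> = a k / A (k + 1) in y k = (1 - \<alpha>) *\<^sub>R x k + \<alpha> *\<^sub>R \<nu> k) \<and>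
           cubic_step f (2 * L) (y k) (x (k + 1)) \<and>
           \<phi> (k + 1) = (\<lambda>z. \<phi> k z
              + a k * (f (x (k + 1)) + grad f (x (k + 1)) \<bullet> (z - x (k + 1))))"
    using assms(6) unfolding modified_accelerated_cubic_newton_def C_def a_def by blast
  have \<phi>1: "\<phi> 1 = (\<lambda>z. f (x 1) + e + C / 6 * norm (z - x 0) ^ 3)"
    using \<phi>1 by (simp add: e_def)
  have min\<phi>: "is_minimizer (\<phi> j) (\<nu> j)" and A_Suc: "A (Suc j) = A j + a j"
    and y: "y j = (1 - a j / A (Suc j)) *\<^sub>R x j + (a j / A (Suc j)) *\<^sub>R \<nu> j"
    and step: "cubic_step f (2 * L) (y j) (x (Suc j))"
    if "j \<ge> 1" for j
    using run[rule_format, OF that] unfolding Let_def Suc_eq_plus1 by blast+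
  have \<phi>_Suc: "\<phi> (Suc j) z = \<phi> j z + a j * (f (x (Suc j)) + grad f (x (Suc j)) \<bullet> (z - x (Suc j)))"
    if "j \<ge> 1" for j z
    using run[rule_format, OF that] by simp
  \<comment> \<open>The weights \<open>a j\<close> are triangular numbers, so their sums are
    tetrahedral; this is the denominator of the final rate.\<close>
  have A: "A j = real j * (real j + 1) * (real j + 2) / 6" if "j \<ge> 1" for j
    using that
  proof (induction j rule: nat_induct_at_least)
    case base
    then show ?case using A1 by simp
  next
    case (Suc j)
    then show ?case using A_Suc[of j] by (simp add: a_def field_simps)
  qed
  have A_a: "A (Suc j) = a j * (real j + 3) / 3" if "j \<ge> 1" for j
    using A[of "Suc j"] by (simp add: a_def field_simps)
  have a: "a j > 0" for j by (simp add: a_def add_pos_pos)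
  have A_pos: "A j > 0" if "j \<ge> 1" for j using that by (simp add: A)

  have min_f: "f xstar \<le> f z" for z using assms(5) by (rule is_minimizer_le)
  have grad_xstar: "grad f xstar = 0" using assms(5) by (rule grad_eq_zero_if_minimizer)
  have f_x1: "f (x 1) - f xstar \<le> L / 3 * R ^ 3"
    using cubic_step_le[OF step1, of xstar] by (simp add: R_def)

  \<comment> \<open>Bounds on the estimating functions\<close>
  have affine: "\<exists>\<beta> b. \<phi> j = (\<lambda>z. \<beta> + b \<bullet> z + C / 6 * norm (z - x 0) ^ 3)" if "j \<ge> 1" for j
    using that
  proof (induction j rule: nat_induct_at_least)
    case base
    show ?case unfolding \<phi>1 by (intro exI[of _ "f (x 1) + e"] exI[of _ 0]) simp
  next
    case (Suc j)
    then obtain \<beta> b where IH: "\<phi> j = (\<lambda>z. \<beta> + b \<bullet> z + C / 6 * norm (z - x 0) ^ 3)" by blast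
    define g where "g = grad f (x (Suc j))"
    have "\<phi> (Suc j) = (\<lambda>z. (\<beta> + a j * (f (x (Suc j)) - g \<bullet> x (Suc j)))
        + (b + a j *\<^sub>R g) \<bullet> z + C / 6 * norm (z - x 0) ^ 3)"
      by (simp add: fun_eq_iff \<phi>_Suc[OF Suc.hyps] IH g_def inner_add_left inner_diff_right algebra_simps)
    then show ?case by blast
  qed
  have \<phi>_bregman: "\<phi> j z = \<phi> j (\<nu> j) + C / 6 * cubic_bregman (\<nu> j - x 0) (z - x 0)" if j: "j \<ge> 1" for j z
  proof -
    obtain \<beta> b where "\<phi> j = (\<lambda>z. \<beta> + b \<bullet> z + C / 6 * norm (z - x 0) ^ 3)" using affine[OF j] by blast
    then show ?thesis using min\<phi>[OF j] C L_pos by (intro cubic_affine_minimizer) auto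
  qed

  \<comment> \<open>Each added tangent lies below \<open>f\<close>. The initial weight A_1 = 1
    multiplies f(x_1) rather than f(z), hence the correction term.\<close>
  have upper: "\<phi> j z \<le> A j * f z + (f (x 1) - f z) + e + C / 6 * norm (z - x 0) ^ 3" if "j \<ge> 1" for j z
    using that
  proof (induction j rule: nat_induct_at_least)
    case base
    show ?case using A1 unfolding \<phi>1 by simp
  next
    case (Suc j)
    have "a j * (f (x (Suc j)) + grad f (x (Suc j)) \<bullet> (z - x (Suc j))) \<le> a j * f z"
      using tangent_le[of "x (Suc j)" "z - x (Suc j)"] a[of j] by (intro mult_left_mono) auto
    then show ?case
      using Suc.IH \<phi>_Suc[OF Suc.hyps, of z] A_Suc[OF Suc.hyps] by (simp add: algebra_simps)
  qed

  \<comment> \<open>One iteration with \<open>w\<close> and \<tau> left free, because it is applied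
    both at the next minimizer \<nu> and at \<open>xstar\<close>. The choice of \<open>y j\<close>
    splits the inner product, convexity handles the part at \<open>x j\<close>, and Young's
    inequality the part with w - \<nu>.\<close>
  have progress: "A (Suc j) * f (x (Suc j)) + A (Suc j) * (3/2 * L * v (Suc j) ^ 3)
      \<le> A j * f (x j) + a j * (f (x (Suc j)) + grad f (x (Suc j)) \<bullet> (w - x (Suc j)))
        + a j * \<tau> * L * v (Suc j) ^ 3 + a j / (2 * \<tau>\<^sup>2) * L * norm (w - \<nu> j) ^ 3"
    if j: "j \<ge> 1" and \<tau>: "\<tau> > 0" for j w \<tau>
  proof -
    define x' g u h where "x' = x (Suc j)" and "g = grad f x'" and "u = v (Suc j)" and "h = norm (w - \<nu> j)"
    have "A (Suc j) *\<^sub>R y j = A j *\<^sub>R x j + a j *\<^sub>R \<nu> j"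
    proof -
      have "A (Suc j) * (1 - a j / A (Suc j)) = A j" "A (Suc j) * (a j / A (Suc j)) = a j"
        using A_pos[of "Suc j"] A_Suc[OF j] by (simp_all add: right_diff_distrib)
      then show ?thesis by (simp only: y[OF j] scaleR_add_right scaleR_scaleR)
    qed
    then have "A (Suc j) * (g \<bullet> y j) = A j * (g \<bullet> x j) + a j * (g \<bullet> \<nu> j)"
      by (metis inner_add_right inner_scaleR_right)
    then have 1: "A (Suc j) * (g \<bullet> (y j - x')) + a j * (g \<bullet> (w - \<nu> j))
        = A j * (g \<bullet> (x j - x')) + a j * (g \<bullet> (w - x'))"
      using A_Suc[OF j] by (simp add: inner_diff_right algebra_simps)
    have "3/2 * L * u ^ 3 \<le> g \<bullet> (y j - x')"
      unfolding g_def x'_def u_def by (rule cubic_step_grad_inner[OF step[OF j] v(1,2)])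
    then have 2: "A (Suc j) * (3/2 * L * u ^ 3) \<le> A (Suc j) * (g \<bullet> (y j - x'))"
      using A_pos[of "Suc j"] by (intro mult_left_mono) auto
    have 3: "A j * (f x' + g \<bullet> (x j - x')) \<le> A j * f (x j)"
      using tangent_le[of x' "x j - x'"] A_pos[OF j] unfolding g_def by (intro mult_left_mono) auto
    have "- (g \<bullet> (w - \<nu> j)) \<le> norm g * h"
      using Cauchy_Schwarz_ineq2[of g "w - \<nu> j"] unfolding h_def by linarith
    also have "\<dots> = L / 2 * (3 * u\<^sup>2 * h)"
      by (simp add: g_def x'_def u_def v(2)[of "Suc j"])
    also have "\<dots> \<le> L / 2 * (h ^ 3 / \<tau>\<^sup>2 + 2 * \<tau> * u ^ 3)"
      using L_pos \<tau> v(1)[of "Suc j"] by (intro mult_left_mono young_cubic) (auto simp: h_def u_def)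
    finally have "a j * (- (g \<bullet> (w - \<nu> j))) \<le> a j * (L / 2 * (h ^ 3 / \<tau>\<^sup>2 + 2 * \<tau> * u ^ 3))"
      using a[of j] by (intro mult_left_mono) auto
    also have "\<dots> = a j * \<tau> * L * u ^ 3 + a j / (2 * \<tau>\<^sup>2) * L * h ^ 3"
      by (simp add: algebra_simps)
    finally have 4: "- (a j * (g \<bullet> (w - \<nu> j))) \<le> a j * \<tau> * L * u ^ 3 + a j / (2 * \<tau>\<^sup>2) * L * h ^ 3" by simp
    have "A (Suc j) * f x' = A j * f x' + a j * f x'" using A_Suc[OF j] by (simp add: algebra_simps)
    with 1 2 3 4 have "A (Suc j) * f x' + A (Suc j) * (3/2 * L * u ^ 3)
      \<le> A j * f (x j) + a j * (f x' + g \<bullet> (w - x')) + a j * \<tau> * L * u ^ 3 + a j / (2 * \<tau>\<^sup>2) * L * h ^ 3"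
      unfolding distrib_left by linarith
    then show ?thesis by (simp only: x'_def g_def u_def h_def)
  qed

  have lower: "A j * f (x j) + e \<le> \<phi> j (\<nu> j)" if "j \<ge> 1" for j
    using that
  proof (induction j rule: nat_induct_at_least)
    case base
    show ?case using A1 C L_pos unfolding \<phi>1 by simp
  next
    case (Suc j)
    define w h where "w = \<nu> (Suc j)" and "h = norm (w - \<nu> j)"
    \<comment> \<open>By \<open>A_a\<close>, this value makes the two gradient terms of
      \<open>progress\<close> cancel exactly. The coefficient left on L h^3 is (j+1)(j+2)/(j+3)^2
      \<le> 1, absorbed since C/6 \<ge> 6L.\<close>
    define \<tau> where "\<tau> = (real j + 3) / 2"
    have \<tau>: "\<tau> > 0" by (simp add: \<tau>_def)
    have "a j / (2 * \<tau>\<^sup>2) \<le> 1"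
      using \<tau> by (simp add: divide_le_eq) (simp add: \<tau>_def a_def power2_eq_square field_simps)
    then have "a j / (2 * \<tau>\<^sup>2) * (L * h ^ 3) \<le> 1 * (L * h ^ 3)"
      using L_pos by (intro mult_right_mono) (auto simp: h_def)
    then have "a j / (2 * \<tau>\<^sup>2) * L * h ^ 3 \<le> L * h ^ 3" by (simp only: mult.assoc mult_1_left)
    moreover have "L * h ^ 3 \<le> C / 6 * cubic_bregman (\<nu> j - x 0) (w - x 0)"
    proof -
      have B: "h ^ 3 \<le> 6 * cubic_bregman (\<nu> j - x 0) (w - x 0)"
        using cubic_bregman_ge[of "w - x 0" "\<nu> j - x 0"] by (simp add: h_def)
      then have "L * h ^ 3 \<le> L * (6 * cubic_bregman (\<nu> j - x 0) (w - x 0))"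
        using L_pos by (intro mult_left_mono) auto
      moreover have "0 \<le> h ^ 3" by (simp add: h_def)
      then have "0 \<le> cubic_bregman (\<nu> j - x 0) (w - x 0)" using B by linarith
      then have "6 * L * cubic_bregman (\<nu> j - x 0) (w - x 0) \<le> C / 6 * cubic_bregman (\<nu> j - x 0) (w - x 0)"
        using C L_pos by (intro mult_right_mono) auto
      ultimately show ?thesis by simp
    qed
    moreover have "a j * \<tau> * L * v (Suc j) ^ 3 = A (Suc j) * (3/2 * L * v (Suc j) ^ 3)"
      by (simp add: A_a[OF Suc.hyps] \<tau>_def)
    ultimately have "A (Suc j) * f (x (Suc j)) + e \<le> \<phi> (Suc j) w"
      using progress[OF Suc.hyps \<tau>, of w, folded h_def] Suc.IH \<phi>_bregman[OF Suc.hyps, of w]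
        \<phi>_Suc[OF Suc.hyps, of w]
      by linarith
    then show ?case by (simp add: w_def)
  qed

  \<comment> \<open>Recovery of the gradient term at the last iterate\<close>
  define S where "S j = f (x j) - f xstar + 1 / sqrt (3 * L) * norm (grad f (x j)) powr (3/2)" for j
  have S: "S j \<le> f (x j) - f xstar + 10608/10000 * L * v j ^ 3" for j
  proof -
    have "sqrt 2 * (3/4 * L * v j ^ 3) \<le> 14143/10000 * (3/4 * L * v j ^ 3)"
      using sqrt2 L_pos v(1)[of j] by (intro mult_right_mono) auto
    moreover have "0 \<le> L * v j ^ 3" using L_pos v(1)[of j] by simp
    ultimately show ?thesis unfolding S_def v(3) by (simp add: mult_ac)
  qed
  have LR: "0 \<le> L * R ^ 3" using L_pos R by simp

  have "A k * S k \<le> 80/6 * L * R ^ 3"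
  proof (cases "k = 1")
    case True
    \<comment> \<open>The iterate x_1 comes from a step with M = L, so its gradient is bounded
      through the step length: at most L (2R)^2. Then v^2 \<le> 8/3 R^2 < (5/3 R)^2.\<close>
    define s where "s = x 1 - x 0"
    have "norm (grad f (x 1) + (L / 2 * norm s) *\<^sub>R s) \<le> L / 2 * (norm s)\<^sup>2"
      using cubic_step_grad[OF step1] L_pos by (simp add: s_def)
    moreover have "norm (grad f (x 1)) \<le> norm (grad f (x 1) + (L / 2 * norm s) *\<^sub>R s) + norm ((L / 2 * norm s) *\<^sub>R s)"
      by (metis norm_triangle_sub add.commute add_diff_cancel_left' norm_minus_commute norm_triangle_ineq4)
    ultimately have "norm (grad f (x 1)) \<le> L * (norm s)\<^sup>2"
      using L_pos by (simp add: power2_eq_square)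
    also have "\<dots> \<le> L * (2 * R)\<^sup>2"
      using cubic_step_norm_le[OF step1 grad_xstar] L_pos
      by (intro mult_left_mono power_mono) (auto simp: s_def R_def norm_minus_commute)
    finally have "L * (v 1)\<^sup>2 \<le> L * (8/3 * R\<^sup>2)"
      unfolding v(2) by (simp add: power_mult_distrib)
    then have "(v 1)\<^sup>2 \<le> 8/3 * R\<^sup>2" using L_pos by simp
    moreover have "(5/3 * R)\<^sup>2 = 25/9 * R\<^sup>2" by (simp add: power_mult_distrib power_divide)
    ultimately have "(v 1)\<^sup>2 \<le> (5/3 * R)\<^sup>2" using zero_le_power2[of R] by linarith
    then have "v 1 \<le> 5/3 * R" using R by (intro power2_le_imp_le[of "v 1"]) auto
    then have "v 1 ^ 3 \<le> (5/3 * R) ^ 3" using v(1)[of 1] by (intro power_mono) auto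
    then have "L * v 1 ^ 3 \<le> L * (125/27 * R ^ 3)"
      using L_pos by (intro mult_left_mono) (auto simp: power_mult_distrib power_divide)
    then show ?thesis using S[of 1] f_x1 A1 LR True by simp
  next
    case False
    define j where "j = k - 1"
    have j: "j \<ge> 1" "k = Suc j" using False assms(7) by (auto simp: j_def)
    define B where "B = cubic_bregman (\<nu> j - x 0) (xstar - x 0)"
    define h u where "h = norm (xstar - \<nu> j)" and "u = v (Suc j)"
    define \<tau> where "\<tau> = 176/1000 * (real j + 3)"
    have \<tau>: "\<tau> > 0" by (simp add: \<tau>_def)
    \<comment> \<open>The term \<open>e\<close> cancels between \<open>lower\<close> and
      \<open>upper\<close>.\<close>
    have "A j * (f (x j) - f xstar) + C / 6 * B \<le> (f (x 1) - f xstar) + C / 6 * R ^ 3"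
      using lower[OF j(1)] upper[OF j(1), of xstar] \<phi>_bregman[OF j(1), of xstar]
      by (simp add: B_def R_def algebra_simps)
    then have main: "A j * (f (x j) - f xstar) + C / 6 * B \<le> L / 3 * R ^ 3 + C / 6 * R ^ 3"
      using f_x1 by simp
    \<comment> \<open>The error L/3 from the first step is below 3/100 of C/6, which meets the
      hypothesis of \<open>cubic_bregman_ge_near\<close>.\<close>
    have "C / 6 * B \<le> C / 6 * (103/100 * R ^ 3)"
    proof -
      have "0 \<le> A j * (f (x j) - f xstar)" using A_pos[OF j(1)] min_f by simp
      moreover have "11656/1000 * L * R ^ 3 \<le> C / 6 * R ^ 3"
        using C R by (intro mult_right_mono) auto
      ultimately show ?thesis using main LR by linarith
    qed
    then have "B \<le> 103/100 * R ^ 3" using C L_pos by simp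
    then have "25/36 * h ^ 3 \<le> B"
      using cubic_bregman_ge_near[of "\<nu> j - x 0" "xstar - x 0"] by (simp add: B_def R_def h_def)
    then have CB: "C / 6 * (25/36 * h ^ 3) \<le> C / 6 * B"
      using C L_pos by (intro mult_left_mono) auto
    have h: "h ^ 3 \<ge> 0" by (simp add: h_def)
    \<comment> \<open>\<open>\<tau>\<close> is about the least value for which this holds.\<close>
    have "a j / (2 * \<tau>\<^sup>2) \<le> 25/36 * 11656/1000"
      using \<tau> by (simp add: divide_le_eq) (simp add: \<tau>_def a_def power2_eq_square field_simps)
    then have "a j / (2 * \<tau>\<^sup>2) * (L * h ^ 3) \<le> 25/36 * 11656/1000 * (L * h ^ 3)"
      using L_pos h by (intro mult_right_mono) auto
    also have "\<dots> \<le> C / 6 * (25/36 * h ^ 3)"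
      using mult_right_mono[OF C(1) h] by simp
    finally have "a j / (2 * \<tau>\<^sup>2) * L * h ^ 3 \<le> C / 6 * B" using CB by (simp add: mult.assoc)
    moreover have "a j * \<tau> * L * u ^ 3 = 528/1000 * (A (Suc j) * (L * u ^ 3))"
      by (simp add: A_a[OF j(1)] \<tau>_def)
    moreover have "a j * (f (x (Suc j)) + grad f (x (Suc j)) \<bullet> (xstar - x (Suc j))) \<le> a j * f xstar"
      using tangent_le[of "x (Suc j)" "xstar - x (Suc j)"] a[of j] by (intro mult_left_mono) auto
    moreover have "A (Suc j) * f xstar = A j * f xstar + a j * f xstar"
      using A_Suc[OF j(1)] by (simp add: algebra_simps)
    moreover have "C / 6 * R ^ 3 \<le> 11658/1000 * L * R ^ 3"
      using C R by (intro mult_right_mono) auto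
    \<comment> \<open>Here 972/1000 = 3/2 - 528/1000 is what remains of the gradient term, and
      11992/1000 bounds 11658/1000 + 1/3.\<close>
    ultimately have fin: "A k * (f (x k) - f xstar) + 972/1000 * (A k * (L * u ^ 3)) \<le> 11992/1000 * (L * R ^ 3)"
      using progress[OF j(1) \<tau>, of xstar, folded h_def u_def] main LR
      unfolding j(2) right_diff_distrib by argo
    have "A k * S k \<le> A k * (f (x k) - f xstar + 10608/10000 * L * v k ^ 3)"
      using S A_pos[OF assms(7)] by (intro mult_left_mono) auto
    also have "\<dots> = A k * (f (x k) - f xstar) + 10608/10000 * (A k * (L * u ^ 3))"
      by (simp add: u_def j(2) algebra_simps)
    finally have "A k * S k \<le> A k * (f (x k) - f xstar) + 10608/10000 * (A k * (L * u ^ 3))" .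
    moreover have "0 \<le> A k * (f (x k) - f xstar)" using A_pos[OF assms(7)] min_f by simp
    moreover have "0 \<le> A k * (L * u ^ 3)"
      using A_pos[OF assms(7)] L_pos v(1)[of "Suc j"] by (simp add: u_def)
    \<comment> \<open>Since the function gap is nonnegative, \<open>fin\<close> may be scaled by
      10608/9720, giving a constant of about 13.09, below 80/6.\<close>
    ultimately show ?thesis using fin LR by linarith
  qed
  then have "S k * (real k * (real k + 1) * (real k + 2)) \<le> 80 * L * R ^ 3"
    using A[OF assms(7)] by (simp add: mult_ac)
  then have "S k \<le> 80 * L * R ^ 3 / (real k * (real k + 1) * (real k + 2))"
    using assms(7) by (subst pos_le_divide_eq) auto
  then show ?thesis by (simp add: S_def R_def norm_minus_commute)
qed

end
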